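(* Let $B(n)$ be the number of distinct cubes occurring in the prefix $\mathbb{T}[1,n]$ of the Tribonacci sequence $\mathbb{T}$, and let $t_m$ be the Tribonacci numbers with $t_{-2}=0$, $t_{-1}=t_0=1$, $t_m=t_{m-1}+t_{m-2}+t_{m-3}$ for $m\ge 1$. Then $B(n)=0$ for $n\le 57$. For $n\ge 58$, let $m$ be the integer such that $t_{m-1}+2t_{m-4}\le n<t_m+2t_{m-3}$; then $m\ge 7$ and $$B(n)=\begin{cases} n-\frac12(4t_{m-1}-t_{m-2}-3t_{m-3}+m-6), & n\le \frac{3t_{m-1}-t_{m-3}-3}{2};\\ \frac12(t_{m-5}+t_{m-6}-m+3), & \text{otherwise}. \end{cases}$$
   Context: The Tribonacci sequence $\mathbb{T}$ is the infinite word over $\{a,b,c\}$ that is the fixed point beginning with $a$ of the substitution $\sigma(a)=ab$, $\sigma(b)=ac$, $\sigma(c)=a$. Letters are indexed from $1$, and $\mathbb{T}[1,n]$ denotes the prefix of $\mathbb{T}$ of length $n$. The notation $u\prec v$ means that $u$ is a factor (contiguous subword) of $v$. The number of distinct cubes is $B(n)=\sharp\{\omega : \omega \text{ a nonempty finite word},\ \omega\omega\omega\prec\mathbb{T}[1,n]\}$. *)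

theory Defs
  imports Complex_Main "HOL-Library.Stream" "HOL-Library.Sublist"
begin

datatype letter = La | Lb | Lc

fun subst_letter :: "letter \<Rightarrow> letter list" where
  "subst_letter La = [La, Lb]"
| "subst_letter Lb = [La, Lc]"
| "subst_letter Lc = [La]"

definition subst_word :: "letter list \<Rightarrow> letter list" where
  "subst_word xs = concat (map subst_letter xs)"

(* No letter has an empty image, so flat is ordinary concatenation here. *)
definition subst_stream :: "letter stream \<Rightarrow> letter stream" where
  "subst_stream w = flat (smap subst_letter w)"

(* The description is proper: see ex1_tribonacci_word below. *)
definition tribonacci_word :: "letter stream" where
  "tribonacci_word = (THE w. shd w = La \<and> subst_stream w = w)"

(* The prefix of length n, written T[1,n] with letters indexed from 1, is stake n. *)
definition tribonacci_prefix :: "nat \<Rightarrow> letter list" where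
  "tribonacci_prefix n = stake n tribonacci_word"

(* sublist is the contiguous-factor relation (as opposed to subseq). *)
definition num_cubes :: "nat \<Rightarrow> nat" where
  "num_cubes n = card {w. w \<noteq> [] \<and> sublist (w @ w @ w) (tribonacci_prefix n)}"

(* Tribonacci numbers t_m for integers m >= -2; the value 0 for m < -2 is an arbitrary
   convention for arguments where t_m is not defined. *)
function trib :: "int \<Rightarrow> int" where
  "trib m = (if m \<le> -2 then 0 else if m \<le> 0 then 1
             else trib (m - 1) + trib (m - 2) + trib (m - 3))"
  by auto
termination by (relation "measure nat") auto

declare trib.simps [simp del]

lemma trib_initial: "trib (-2) = 0" "trib (-1) = 1" "trib 0 = 1"
  by (simp_all add: trib.simps)

lemma trib_rec: "m \<ge> 1 \<Longrightarrow> trib m = trib (m - 1) + trib (m - 2) + trib (m - 3)"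
  by (subst trib.simps) simp

lemma subst_letter_neq_Nil [simp]: "subst_letter x \<noteq> []"
  by (cases x) auto

lemma subst_word_append [simp]: "subst_word (xs @ ys) = subst_word xs @ subst_word ys"
  by (simp add: subst_word_def)

lemma subst_word_simps [simp]:
  "subst_word [] = []" "subst_word (x # xs) = subst_letter x @ subst_word xs"
  by (simp_all add: subst_word_def)

lemma subst_stream_shift: "subst_stream (xs @- w) = subst_word xs @- subst_stream w"
  by (induction xs) (simp_all add: subst_stream_def subst_word_def)

abbreviation iter_a :: "nat \<Rightarrow> letter list" where
  "iter_a k \<equiv> (subst_word ^^ k) [La]"

lemma iter_a_extends: "\<exists>ys. iter_a (Suc k) = iter_a k @ La # ys \<or> iter_a (Suc k) = iter_a k @ Lb # ys"
proof (induction k)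
  case 0
  show ?case by simp
next
  case (Suc k)
  then obtain ys where "iter_a (Suc k) = iter_a k @ La # ys \<or> iter_a (Suc k) = iter_a k @ Lb # ys"
    by blast
  then have "subst_word (iter_a (Suc k)) = subst_word (iter_a k) @ subst_word (La # ys)
      \<or> subst_word (iter_a (Suc k)) = subst_word (iter_a k) @ subst_word (Lb # ys)"
    by (metis subst_word_append)
  then show ?case by auto
qed

lemma prefix_iter_a_Suc: "prefix (iter_a k) (iter_a (Suc k))"
  using iter_a_extends[of k] by (auto simp: prefix_def)

lemma prefix_iter_a: "k \<le> l \<Longrightarrow> prefix (iter_a k) (iter_a l)"
proof (induction rule: dec_induct)
  case (step l)
  then show ?case using prefix_iter_a_Suc prefix_order.trans by blast
qed simp

lemma length_iter_a: "k < length (iter_a k)"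
proof (induction k)
  case (Suc k)
  have "length (iter_a k) < length (iter_a (Suc k))"
    using iter_a_extends[of k] by auto
  with Suc show ?case by simp
qed simp

lemma stake_iter_a_unique:
  assumes "\<And>k. stake (length (iter_a k)) v = iter_a k"
    and "\<And>k. stake (length (iter_a k)) w = iter_a k"
  shows "v = w"
proof -
  have "v !! i = w !! i" for i
    using assms[of i] length_iter_a[of i] by (metis stake_nth)
  then show ?thesis by (metis stream_smap_nats smap_alt)
qed

lemma stake_subst_stream:
  assumes "stake (length (iter_a k)) w = iter_a k"
  shows "stake (length (iter_a (Suc k))) (subst_stream w) = iter_a (Suc k)"
proof -
  have "w = iter_a k @- sdrop (length (iter_a k)) w"
    using assms by (metis stake_sdrop)
  then have "subst_stream w = iter_a (Suc k) @- subst_stream (sdrop (length (iter_a k)) w)"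
    by (metis subst_stream_shift funpow.simps(2) comp_apply)
  then show ?thesis by (simp add: stake_shift)
qed

lemma ex1_tribonacci_word: "\<exists>!w. shd w = La \<and> subst_stream w = w"
proof -
  have fix_prefix: "stake (length (iter_a k)) w = iter_a k"
    if "shd w = La" "subst_stream w = w" for w k
  proof (induction k)
    case 0
    then show ?case using that by simp
  next
    case (Suc k)
    then show ?case using stake_subst_stream[OF Suc] that by simp
  qed
  define w where "w = smap (\<lambda>i. iter_a i ! i) nats"
  have w: "stake (length (iter_a k)) w = iter_a k" for k
  proof (rule nth_equalityI)
    fix i assume i: "i < length (stake (length (iter_a k)) w)"
    have "iter_a i ! i = iter_a k ! i"
    proof (cases "i \<le> k")
      case True
      then show ?thesis using prefix_iter_a[OF True] length_iter_a[of i]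
        by (auto simp: prefix_def nth_append)
    next
      case False
      then have "prefix (iter_a k) (iter_a i)" by (intro prefix_iter_a) simp
      then show ?thesis using i by (auto simp: prefix_def nth_append)
    qed
    then show "stake (length (iter_a k)) w ! i = iter_a k ! i"
      using i by (simp add: w_def)
  qed simp
  have sw: "stake (length (iter_a k)) (subst_stream w) = iter_a k" for k
  proof (cases k)
    case 0
    then show ?thesis by (simp add: w_def subst_stream_def)
  next
    case (Suc l)
    then show ?thesis using stake_subst_stream[OF w[of l]] by simp
  qed
  show ?thesis
  proof (rule ex1I[of _ w])
    show "shd w = La \<and> subst_stream w = w"
      using w[of 0] stake_iter_a_unique[OF sw w] by simp
  next
    fix v assume "shd v = La \<and> subst_stream v = v"
    then show "v = w" using stake_iter_a_unique[of v w] fix_prefix[of v] w by blast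
  qed
qed

lemma tribonacci_word:
  "shd tribonacci_word = La" "subst_stream tribonacci_word = tribonacci_word"
  using theI'[OF ex1_tribonacci_word] by (simp_all add: tribonacci_word_def)

end

theory Submission
  imports Defs
begin

text \<open>
  The substitution cuts the word into blocks \<open>ab\<close>, \<open>ac\<close>, \<open>a\<close>, and the block structure can be read off
  locally: every \<open>a\<close> opens a block, and different blocks differ in their last letter and in the
  letter that follows their first one. Hence a stretch on which the word agrees with its shift by
  \<open>L\<close>, if it cannot be extended to the left, is the image of such a stretch with a shorter shift,
  followed by one further \<open>a\<close>. If the stretch has length at least \<open>2 * L - 1\<close>, so has its preimage
  relative to its own shift. The descent can only end at an occurrence of the factor \<open>aa\<close>, with
  shift 1 and a stretch of length 1.

  Reading this backwards, every cube lies in one of the runs of level \<open>k\<close>: the run that grows out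
  of an occurrence of \<open>aa\<close> at position \<open>j\<close> starts at the image of \<open>j\<close> under the \<open>k\<close>-th iterate of
  the substitution, its period is \<open>|\<sigma>^k(a)| = t_k\<close>, and it agrees with its shift on exactly the
  word \<open>\<sigma>^k(a) \<dots> \<sigma>(a) a\<close> (lemmas \<open>factor_at_run_word\<close> and
  \<open>long_repetition_classification\<close>). All runs of level \<open>k\<close> carry
  the same cubes, so each cube occurs first in the run that comes from the first \<open>aa\<close>, at position
  6. There the first cube ends at \<open>t_(k+3) + 2 t_k\<close>, and the others end at the positions that
  follow, one at each. They are pairwise different, since two equal ones would create a repetition
  with a shift below \<open>t_k\<close> that is too long for the classification (lemma \<open>cube_root_inj\<close>).

  With \<open>c_k\<close> cubes at level \<open>k \<ge> 3\<close>, where \<open>2 c_k = t_(k-1) - t_(k-3) - 1\<close>, the count therefore grows by one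
  per letter on \<open>c_k\<close> consecutive prefix lengths and then stays constant until level \<open>k + 1\<close> begins.
  The parameter \<open>m\<close> of the theorem is \<open>k + 4\<close>.
\<close>

section \<open>Blocks of the Tribonacci word\<close>

abbreviation tri :: "nat \<Rightarrow> letter" where
  "tri i \<equiv> tribonacci_word !! i"

declare snth.simps(2) [simp del]

definition factor_at :: "nat \<Rightarrow> nat \<Rightarrow> letter list" where
  "factor_at p l = stake l (sdrop p tribonacci_word)"

text \<open>
  Positions count from 0. As \<open>|\<sigma>(u)|\<close> for the prefix \<open>u\<close> of length \<open>j\<close>, this is where the image of
  the \<open>j\<close>-th letter begins; it is also the position of the \<open>j\<close>-th letter \<open>a\<close>. Its iterates locate
  the images under powers of the substitution.
\<close>

definition block_start :: "nat \<Rightarrow> nat" where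
  "block_start j = length (subst_word (stake j tribonacci_word))"

lemma length_factor_at [simp]: "length (factor_at p l) = l"
  by (simp add: factor_at_def)

lemma nth_factor_at [simp]: "i < l \<Longrightarrow> factor_at p l ! i = tri (p + i)"
  by (simp add: factor_at_def sdrop_snth)

lemma factor_at_eq_iff: "factor_at p l = factor_at q l \<longleftrightarrow> (\<forall>i<l. tri (p + i) = tri (q + i))"
  by (simp add: list_eq_iff_nth_eq)

lemma factor_at_add: "factor_at p (k + l) = factor_at p k @ factor_at (p + k) l"
  using stake_add[of k "sdrop p tribonacci_word" l] by (simp add: factor_at_def sdrop_add)

lemma factor_at_0 [simp]: "factor_at p 0 = []"
  by (simp add: factor_at_def)

lemma factor_at_Suc: "factor_at p (Suc l) = tri p # factor_at (Suc p) l"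
  by (simp add: factor_at_def sdrop_simps)

text \<open>
  The fixed point equation, split at the \<open>j\<close>-th block boundary. All local information about blocks
  comes from here.
\<close>

lemma sdrop_block_start:
  "sdrop (block_start j) tribonacci_word = subst_stream (sdrop j tribonacci_word)"
proof -
  have "tribonacci_word = subst_stream (stake j tribonacci_word @- sdrop j tribonacci_word)"
    using tribonacci_word(2) by (simp add: stake_sdrop)
  then have eq: "tribonacci_word =
      subst_word (stake j tribonacci_word) @- subst_stream (sdrop j tribonacci_word)"
    by (simp add: subst_stream_shift)
  have "sdrop (block_start j) tribonacci_word = sdrop (block_start j)
      (subst_word (stake j tribonacci_word) @- subst_stream (sdrop j tribonacci_word))"
    using arg_cong[OF eq, of "sdrop (block_start j)"] .
  then show ?thesis by (simp add: block_start_def sdrop_shift)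
qed

lemma block_start_add: "block_start (j + l) = block_start j + length (subst_word (factor_at j l))"
proof -
  have "stake (j + l) tribonacci_word = stake j tribonacci_word @ factor_at j l"
    by (simp add: factor_at_def stake_add)
  then show ?thesis by (simp add: block_start_def)
qed

lemma block_start_0 [simp]: "block_start 0 = 0"
  by (simp add: block_start_def)

lemma block_start_Suc: "block_start (Suc j) = block_start j + length (subst_letter (tri j))"
  using block_start_add[of j 1] by (simp add: factor_at_Suc)

lemma factor_at_block_start:
  "factor_at (block_start j) (length (subst_word (factor_at j l))) = subst_word (factor_at j l)"
proof -
  have "sdrop (block_start j) tribonacci_word =
      subst_word (factor_at j l) @- subst_stream (sdrop (j + l) tribonacci_word)"
    using stake_sdrop[of l "sdrop j tribonacci_word"]
      subst_stream_shift[of "factor_at j l" "sdrop (j + l) tribonacci_word"]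
    by (simp add: sdrop_block_start factor_at_def sdrop_add)
  then show ?thesis
    by (simp add: factor_at_def stake_shift)
qed

lemma tri_in_block:
  assumes "i < length (subst_letter (tri j))"
  shows "tri (block_start j + i) = subst_letter (tri j) ! i"
proof -
  have "subst_word (factor_at j 1) = subst_letter (tri j)"
    by (simp add: factor_at_Suc)
  with factor_at_block_start[of j 1] nth_factor_at[OF assms, of "block_start j"]
  show ?thesis by simp
qed

lemma tri_block_start [simp]: "tri (block_start j) = La"
  using tri_in_block[of 0 j] by (cases "tri j") auto

text \<open>
  The letter after the start of a block determines the block, because \<open>\<sigma>(c) = a\<close> is always followed
  by the \<open>a\<close> of the next block. This is what stops the image of a repetition on the right.
\<close>

lemma tri_Suc_block_start:
  "tri (Suc (block_start j)) = (case tri j of La \<Rightarrow> Lb | Lb \<Rightarrow> Lc | Lc \<Rightarrow> La)"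
proof (cases "tri j")
  case Lc
  then have "Suc (block_start j) = block_start (Suc j)" by (simp add: block_start_Suc)
  then show ?thesis using Lc by simp
qed (use tri_in_block[of 1 j] in auto)

text \<open>
  The last letter determines the block as well, so agreement with a shift cannot stretch to the left
  across images of different letters, and it does stretch across images of equal ones.
\<close>

lemma tri_block_end:
  "tri (block_start (Suc j) - 1) = (case tri j of La \<Rightarrow> Lb | Lb \<Rightarrow> Lc | Lc \<Rightarrow> La)"
  using tri_Suc_block_start[of j] tri_block_start[of j]
  by (cases "tri j") (auto simp: block_start_Suc)

lemma strict_mono_block_start: "strict_mono block_start"
  by (simp add: strict_mono_Suc_iff block_start_Suc)

lemma strict_mono_block_start_pow: "strict_mono (block_start ^^ k)"
  by (induction k) (auto simp: strict_mono_def strict_mono_less[OF strict_mono_block_start])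

lemma block_start_add_ge: "block_start j + l \<le> block_start (j + l)"
proof (induction l)
  case (Suc l)
  have "block_start (j + l) < block_start (j + Suc l)"
    using block_start_Suc[of "j + l"] by simp
  with Suc show ?case by simp
qed simp

lemma position_cases:
  obtains j where "p = block_start j" | j where "p = Suc (block_start j)" "tri p \<noteq> La"
proof -
  have "(\<exists>j. p = block_start j) \<or> (\<exists>j. p = Suc (block_start j) \<and> tri p \<noteq> La)"
  proof (induction p)
    case 0
    show ?case by (metis block_start_0)
  next
    case (Suc p)
    then show ?case
    proof (elim disjE exE conjE)
      fix j assume p: "p = block_start j"
      then show ?case
        using tri_Suc_block_start[of j] block_start_Suc[of j]
        by (cases "tri j") (auto intro: exI[of _ "Suc j"])
    next
      fix j assume p: "p = Suc (block_start j)" "tri p \<noteq> La"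
      then have "Suc p = block_start (Suc j)"
        using tri_Suc_block_start[of j] by (cases "tri j") (auto simp: block_start_Suc)
      then show ?case by blast
    qed
  qed
  then show ?thesis using that by blast
qed

lemma La_imp_block_start: "tri p = La \<Longrightarrow> \<exists>j. p = block_start j"
  by (metis position_cases)

lemma before_non_La: "tri p \<noteq> La \<Longrightarrow> 0 < p \<and> tri (p - 1) = La"
  by (metis position_cases tri_block_start diff_Suc_1 zero_less_Suc)

lemma no_Lc_Lc: "\<not> (tri p = Lc \<and> tri (Suc p) = Lc)"
  using before_non_La[of "Suc p"] by auto

lemma no_La_La_La: "\<not> (tri p = La \<and> tri (Suc p) = La \<and> tri (Suc (Suc p)) = La)"
proof
  assume *: "tri p = La \<and> tri (Suc p) = La \<and> tri (Suc (Suc p)) = La"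
  then obtain j where j: "p = block_start j" using La_imp_block_start by blast
  with * have "tri j = Lc" using tri_Suc_block_start[of j] by (cases "tri j") auto
  with j have "Suc p = block_start (Suc j)" by (simp add: block_start_Suc)
  with * have "tri (Suc j) = Lc" using tri_Suc_block_start[of "Suc j"] by (cases "tri (Suc j)") auto
  with \<open>tri j = Lc\<close> no_Lc_Lc show False by blast
qed

text \<open>
  Two consecutive letters have an image of length at least 3, as they are not \<open>cc\<close>. This bounds the
  loss when the length of a repetition is compared with that of its preimage.
\<close>

lemma block_start_two: "block_start j + 3 \<le> block_start (j + 2)"
  using no_Lc_Lc[of j]
  by (cases "tri j"; cases "tri (Suc j)") (auto simp: numeral_2_eq_2 block_start_Suc)

section \<open>Classification of long repetitions\<close>

text \<open>
  The words on which a run of level \<open>k\<close> agrees with its own shift. The appended \<open>a\<close> is the common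
  first letter of the two different blocks at which the agreement stops.
\<close>

primrec run_word :: "nat \<Rightarrow> letter list" where
  "run_word 0 = [La]"
| "run_word (Suc k) = subst_word (run_word k) @ [La]"

text \<open>
  The \<open>a\<close> that each level appends is the first letter of whichever block comes next, so the letter
  \<open>a\<close> at \<open>j\<close> alone forces the run word at the image of \<open>j\<close>. Applied to both
  letters of a factor \<open>aa\<close> it yields a repetition.
\<close>

lemma factor_at_run_word:
  assumes "tri j = La"
  shows "factor_at ((block_start ^^ k) j) (length (run_word k)) = run_word k"
proof (induction k)
  case 0
  show ?case using assms by (simp add: factor_at_Suc)
next
  case (Suc k)
  let ?p = "(block_start ^^ k) j" and ?n = "length (run_word k)"
  have "factor_at (block_start ?p) (length (run_word (Suc k))) =
    factor_at (block_start ?p) (length (subst_word (factor_at ?p ?n))) @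
    factor_at (block_start (?p + ?n)) 1"
    using factor_at_add[of "block_start ?p" "length (subst_word (run_word k))" 1]
    unfolding block_start_add Suc.IH by simp
  also have "\<dots> = run_word (Suc k)"
    unfolding factor_at_block_start by (simp add: Suc.IH factor_at_Suc)
  finally show ?case by simp
qed

lemma stake_block_start_pow:
  "stake ((block_start ^^ k) j) tribonacci_word = (subst_word ^^ k) (stake j tribonacci_word)"
proof (induction k)
  case (Suc k)
  have "stake (block_start i) tribonacci_word = subst_word (stake i tribonacci_word)" for i
    using factor_at_block_start[of 0 i] by (simp add: factor_at_def block_start_def)
  with Suc show ?case by simp
qed simp

lemma subst_word_pow_append:
  "(subst_word ^^ k) (xs @ ys) = (subst_word ^^ k) xs @ (subst_word ^^ k) ys"
  by (induction k) auto

lemma block_start_pow_Suc: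
  assumes "tri j = La"
  shows "(block_start ^^ k) (Suc j) = (block_start ^^ k) j + length (iter_a k)"
proof -
  have "(block_start ^^ k) i = length ((subst_word ^^ k) (stake i tribonacci_word))" for i
    using arg_cong[OF stake_block_start_pow, of length] by simp
  moreover have "stake (Suc j) tribonacci_word = stake j tribonacci_word @ [La]"
    using assms by (simp add: stake_Suc del: stake.simps)
  ultimately show ?thesis by (simp add: subst_word_pow_append)
qed

text \<open>
  Two equal stretches that start at block boundaries consist of equal blocks up to the first pair of
  different ones, and of these they share the letter \<open>a\<close> only.
\<close>

lemma desubstitute_repetition:
  assumes rep: "factor_at (block_start j) l = factor_at (block_start (j + L)) l"
  obtains l' where "factor_at j l' = factor_at (j + L) l'"
    and "l \<le> Suc (length (subst_word (factor_at j l')))"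
proof (cases "\<exists>i. tri (j + i) \<noteq> tri (j + L + i)")
  case False
  (* Both sides agree forever, so any l' that is long enough will do. *)
  then have "factor_at j l = factor_at (j + L) l" by (simp add: factor_at_eq_iff)
  moreover have "l \<le> length (subst_word (factor_at j l))"
    using block_start_add_ge[of j l] by (simp add: block_start_add)
  ultimately show ?thesis using that[of l] by simp
next
  case True
  define l' where "l' = (LEAST i. tri (j + i) \<noteq> tri (j + L + i))"
  have neq: "tri (j + l') \<noteq> tri (j + L + l')"
    using LeastI_ex[OF True] by (simp add: l'_def)
  have eq: "factor_at j l' = factor_at (j + L) l'"
    unfolding factor_at_eq_iff using not_less_Least l'_def by blast
  let ?n = "length (subst_word (factor_at j l'))"
  have "tri (Suc (block_start (j + l'))) \<noteq> tri (Suc (block_start (j + L + l')))"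
    using neq unfolding tri_Suc_block_start by (auto split: letter.splits)
  then have "tri (block_start j + Suc ?n) \<noteq> tri (block_start (j + L) + Suc ?n)"
    by (simp add: block_start_add[of _ l'] eq)
  then have "\<not> Suc ?n < l"
    using rep unfolding factor_at_eq_iff by blast
  with eq that show ?thesis by (metis not_less)
qed

text \<open>
  The bound \<open>2 * L - 1\<close>, one less than a cube requires, is what the descent preserves: an agreement
  one letter short of two periods can have an image that covers two periods in full. Indeed, the
  shifts 1, 2, 4 of the first three levels come with agreements of length 1, 3, 7, and only the next
  level, with shift 7 and length 14, contains a cube.
\<close>

lemma long_repetition_classification:
  assumes "0 < L" and "2 * L \<le> Suc l" and "factor_at p l = factor_at (p + L) l"
    and "p = 0 \<or> tri (p - 1) \<noteq> tri (p + L - 1)"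
  shows "\<exists>k j. tri j = La \<and> tri (Suc j) = La \<and> p = (block_start ^^ k) j
    \<and> L = length (iter_a k) \<and> l \<le> length (run_word k)"
  using assms
proof (induction L arbitrary: p l rule: less_induct)
  case (less L)
  have rep: "tri (p + i) = tri (p + L + i)" if "i < l" for i
    using less.prems(3) that by (simp add: factor_at_eq_iff)
  have "0 < l" using less.prems(1,2) by simp
  (* Any other letter is preceded by an a, here and one shift later, and the repetition could be
     extended to the left. *)
  have "tri p = La"
  proof (rule ccontr)
    assume "tri p \<noteq> La"
    moreover from this have "tri (p + L) \<noteq> La" using rep[of 0] \<open>0 < l\<close> by simp
    ultimately show False
      using before_non_La[of p] before_non_La[of "p + L"] less.prems(4) by auto
  qed
  then obtain j where p: "p = block_start j" using La_imp_block_start by blast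
  have "tri (p + L) = La" using rep[of 0] \<open>0 < l\<close> \<open>tri p = La\<close> by simp
  then obtain j2 where j2: "p + L = block_start j2" using La_imp_block_start by blast
  have "j < j2"
    using p j2 less.prems(1) strict_mono_less[OF strict_mono_block_start, of j j2] by simp
  then obtain L' where L': "j2 = j + L'" "0 < L'" using less_imp_add_positive by blast
  have L: "block_start (j + L') = block_start j + L" using p j2 L' by simp
  obtain l' where l': "factor_at j l' = factor_at (j + L') l'"
    "l \<le> Suc (length (subst_word (factor_at j l')))"
    using desubstitute_repetition[of j l L'] less.prems(3) p L by metis
  have l'_start: "l \<le> Suc (block_start (j + l') - block_start j)"
    using l'(2) by (simp add: block_start_add)
  have "L' \<le> L" using block_start_add_ge[of j L'] L by simp
  show ?case
  proof (cases "L' = L")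
    case True
    (* The descent ends here: all blocks in the period have length 1, so the period is a single c in
       the preimage, and the repetition is aa. *)
    have "L' < 2"
    proof (rule ccontr)
      assume "\<not> L' < 2"
      then obtain r where r: "L' = 2 + r" by (metis le_add_diff_inverse not_less)
      have "block_start j + 3 + r \<le> block_start (j + L')"
        using block_start_two[of j] block_start_add_ge[of "j + 2" r]
        by (simp add: r add.assoc)
      with L True r show False by simp
    qed
    with True L' have "L = 1" by simp
    have "l \<le> 1"
    proof (rule ccontr)
      assume "\<not> l \<le> 1"
      then show False
        using rep[of 0] rep[of 1] \<open>tri p = La\<close> \<open>L = 1\<close> no_La_La_La[of p] by simp
    qed
    moreover have "tri (Suc p) = La" using \<open>tri (p + L) = La\<close> \<open>L = 1\<close> by simp
    ultimately show ?thesis using \<open>tri p = La\<close> \<open>L = 1\<close>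
      by (intro exI[of _ 0] exI[of _ p]) simp
  next
    case False
    with \<open>L' \<le> L\<close> have "L' < L" by simp
    have "2 * L' \<le> Suc l'"
    proof (rule ccontr)
      assume "\<not> 2 * L' \<le> Suc l'"
      then have small: "l' + 2 \<le> 2 * L'" by simp
      (* At least two letters are missing to a square in the preimage, hence at least three in the
         image, of which the appended a supplies only one. *)
      have "block_start (j + l') + 3 \<le> block_start j + 2 * L"
      proof (cases "l' \<le> L'")
        case True
        then have le: "block_start (j + l') \<le> block_start j + L"
          using L strict_mono_less_eq[OF strict_mono_block_start, of "j + l'" "j + L'"] by simp
        show ?thesis
        proof (cases "L' = 1")
          case True
          then have "l' = 0" using small by simp
          then show ?thesis using \<open>L' < L\<close> True by simp
        next
          case False
          then show ?thesis using le \<open>L' < L\<close> L'(2) by simp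
        qed
      next
        case False
        then obtain q where q: "l' = L' + q" by (metis le_add_diff_inverse nle_le)
        have "factor_at j q = factor_at (j + L') q"
          using l'(1) q by (simp add: factor_at_eq_iff)
        then have "block_start (j + l') = block_start (j + q) + L"
          using L block_start_add[of "j + L'" q] block_start_add[of j q] q
          by (simp add: add.assoc)
        moreover have "block_start (j + q) + 3 \<le> block_start (j + L')"
          using block_start_two[of "j + q"] small q
            strict_mono_less_eq[OF strict_mono_block_start, of "j + q + 2" "j + L'"] by simp
        ultimately show ?thesis using L by simp
      qed
      moreover have "block_start j \<le> block_start (j + l')"
        using strict_mono_less_eq[OF strict_mono_block_start] by simp
      ultimately show False using l'_start less.prems(2) by linarith
    qed
    moreover have "j = 0 \<or> tri (j - 1) \<noteq> tri (j + L' - 1)"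
    proof (rule ccontr)
      assume *: "\<not> (j = 0 \<or> tri (j - 1) \<noteq> tri (j + L' - 1))"
      then obtain j' where "j = Suc j'" by (cases j) auto
      moreover have "tri (p - 1) = tri (p + L - 1)"
        using * tri_block_end[of "j - 1"] tri_block_end[of "j + L' - 1"] p L \<open>j = Suc j'\<close>
        by simp
      moreover have "p \<noteq> 0"
        using p \<open>j = Suc j'\<close> by (simp add: block_start_Suc)
      ultimately show False using less.prems(4) by blast
    qed
    ultimately obtain k i where ki: "tri i = La" "tri (Suc i) = La" "j = (block_start ^^ k) i"
      "L' = length (iter_a k)" "l' \<le> length (run_word k)"
      using less.IH[OF \<open>L' < L\<close> L'(2) _ l'(1)] by blast
    have "block_start j + L = (block_start ^^ Suc k) (Suc i)"
      using L ki by (simp add: block_start_pow_Suc)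
    then have "L = length (iter_a (Suc k))"
      using block_start_pow_Suc[OF ki(1), of "Suc k"] ki(3) by simp
    moreover have "l \<le> length (run_word (Suc k))"
    proof -
      have "block_start (j + l') \<le> block_start (j + length (run_word k))"
        using ki(5) strict_mono_less_eq[OF strict_mono_block_start] by simp
      also have "\<dots> = block_start j + length (subst_word (run_word k))"
        using factor_at_run_word[OF ki(1), of k] ki(3) by (simp add: block_start_add)
      finally show ?thesis using l'_start by simp
    qed
    ultimately show ?thesis
      using ki p by (intro exI[of _ "Suc k"] exI[of _ i]) simp
  qed
qed

text \<open>
  Choosing the least possible start makes a repetition maximal to the left, as the descent needs.
\<close>

lemma extend_repetition_left:
  assumes "factor_at p l = factor_at (p + L) l"
  obtains q where "q \<le> p" and "factor_at q (p - q + l) = factor_at (q + L) (p - q + l)"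
    and "q = 0 \<or> tri (q - 1) \<noteq> tri (q + L - 1)"
proof -
  let ?P = "\<lambda>q. q \<le> p \<and> factor_at q (p - q + l) = factor_at (q + L) (p - q + l)"
  define q where "q = (LEAST q. ?P q)"
  have q: "?P q" unfolding q_def using assms by (intro LeastI[of ?P p]) simp
  have "q = 0 \<or> tri (q - 1) \<noteq> tri (q + L - 1)"
  proof (rule ccontr)
    assume *: "\<not> (q = 0 \<or> tri (q - 1) \<noteq> tri (q + L - 1))"
    then obtain r where r: "q = Suc r" by (cases q) auto
    have "p - r + l = Suc (p - q + l)" using q r by arith
    then have "factor_at r (p - r + l) = factor_at (r + L) (p - r + l)"
      using q * r by (simp only: factor_at_Suc) simp
    then have "?P r" using q r by simp
    then show False using not_less_Least[of r ?P] r unfolding q_def by simp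
  qed
  with q that show ?thesis by blast
qed

lemma repetition_classification:
  assumes "0 < L" and "2 * L \<le> l" and "factor_at p l = factor_at (p + L) l"
  obtains k j i where "tri j = La" "tri (Suc j) = La" "p = (block_start ^^ k) j + i"
    "L = length (iter_a k)" "i + l \<le> length (run_word k)"
proof -
  obtain q where q: "q \<le> p" "factor_at q (p - q + l) = factor_at (q + L) (p - q + l)"
    "q = 0 \<or> tri (q - 1) \<noteq> tri (q + L - 1)"
    using extend_repetition_left[OF assms(3)] .
  obtain k j where "tri j = La" "tri (Suc j) = La" "q = (block_start ^^ k) j"
    "L = length (iter_a k)" "p - q + l \<le> length (run_word k)"
    using long_repetition_classification[OF assms(1) _ q(2,3)] assms(2) by auto
  with that[of j k "p - q"] q(1) show ?thesis by simp
qed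

section \<open>Lengths and Tribonacci numbers\<close>

lemma length_iter_a_rec:
  "length (iter_a (k + 3)) = length (iter_a (k + 2)) + length (iter_a (k + 1)) + length (iter_a k)"
proof -
  have "iter_a (k + 3) = (subst_word ^^ k) (iter_a 3)"
    by (simp only: funpow_add o_apply)
  also have "iter_a 3 = iter_a 2 @ iter_a 1 @ iter_a 0"
    by (simp add: eval_nat_numeral)
  finally show ?thesis
    by (simp only: subst_word_pow_append funpow_add o_apply length_append add.assoc) simp
qed

lemma length_iter_a_small:
  "length (iter_a 0) = 1" "length (iter_a (Suc 0)) = 2" "length (iter_a 2) = 4"
  "length (iter_a 3) = 7"
  by (simp_all add: eval_nat_numeral)

lemma length_iter_a_mono: "k \<le> l \<Longrightarrow> length (iter_a k) \<le> length (iter_a l)"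
  using prefix_iter_a prefix_length_le by blast

lemma length_iter_a_double: "length (iter_a (Suc k)) \<le> 2 * length (iter_a k)"
proof -
  have "length (subst_word xs) \<le> 2 * length xs" for xs
  proof (induction xs)
    case (Cons x xs)
    then show ?case by (cases x) auto
  qed simp
  then show ?thesis by simp
qed

lemma trib_eq_length_iter_a: "trib (int k) = int (length (iter_a k))"
proof (induction k rule: less_induct)
  case (less k)
  consider "k = 0" | "k = 1" | "k = 2" | "3 \<le> k" by linarith
  then show ?case
  proof cases
    case 4
    then obtain i where i: "k = i + 3" by (metis add.commute le_add_diff_inverse)
    have "trib (int k) = trib (int (i + 2)) + trib (int (i + 1)) + trib (int i)"
      using trib_rec[of "int k"] i by (simp add: algebra_simps)
    also have "\<dots> = int (length (iter_a k))"
      using less.IH[of "i + 2"] less.IH[of "i + 1"] less.IH[of i] i length_iter_a_rec[of i]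
      by simp
    finally show ?thesis .
  qed (simp_all add: trib.simps length_iter_a_small)
qed

lemma run_word_Suc: "run_word (Suc k) = iter_a (Suc k) @ run_word k"
  by (induction k) auto

text \<open>
  By \<open>run_word_Suc\<close> the length of the run word is \<open>t_0 + \<dots> + t_k\<close>; this is the closed form of that sum.
\<close>

lemma length_run_word:
  "2 * length (run_word k) + 3 = length (iter_a (k + 2)) + length (iter_a k)"
proof (induction k)
  case 0
  then show ?case by (simp add: length_iter_a_small)
next
  case (Suc k)
  then show ?case
    using length_iter_a_rec[of k] unfolding run_word_Suc by (simp add: add.commute numeral_3_eq_3)
qed

lemma stake_tribonacci_word_8: "stake 8 tribonacci_word = [La, Lb, La, Lc, La, Lb, La, La]"
proof -
  have 1: "stake 1 tribonacci_word = [La]" using tribonacci_word(1) by simp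
  have 2: "stake ((block_start ^^ 4) 1) tribonacci_word = iter_a 4"
    using stake_block_start_pow[of 4 1] 1 by simp
  have "length (iter_a 4) = 13" by (simp add: eval_nat_numeral)
  then have 3: "stake 13 tribonacci_word = iter_a 4"
    using arg_cong[OF 2, of length] 2 by simp
  have "stake 8 tribonacci_word = take 8 (stake 13 tribonacci_word)"
    by (simp add: take_stake)
  with 3 show ?thesis by (simp add: eval_nat_numeral)
qed

lemma first_La_La:
  "tri 6 = La" "tri (Suc 6) = La"
  "tri j = La \<Longrightarrow> tri (Suc j) = La \<Longrightarrow> 6 \<le> j"
proof -
  have nth: "tri i = [La, Lb, La, Lc, La, Lb, La, La] ! i" if "i < 8" for i
    using stake_tribonacci_word_8 stake_nth[OF that, of tribonacci_word] by simp
  show "tri 6 = La" "tri (Suc 6) = La" using nth[of 6] nth[of 7] by simp_all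
  assume *: "tri j = La" "tri (Suc j) = La"
  show "6 \<le> j"
  proof (rule ccontr)
    assume "\<not> 6 \<le> j"
    then have "j = 0 \<or> j = 1 \<or> j = 2 \<or> j = 3 \<or> j = 4 \<or> j = 5" by linarith
    with * nth[of j] nth[of "Suc j"] show False by auto
  qed
qed

text \<open>
  The prefix \<open>abacaba\<close>, which ends with the first letter of the first \<open>aa\<close>, is \<open>\<sigma>^3(a)\<close>.
\<close>

lemma block_start_pow_6: "(block_start ^^ k) 6 + length (iter_a k) = length (iter_a (k + 3))"
proof -
  have "take 7 (stake 8 tribonacci_word) = stake 7 tribonacci_word"
    by (simp add: take_stake)
  then have "stake 7 tribonacci_word = iter_a 3"
    unfolding stake_tribonacci_word_8 by (simp add: eval_nat_numeral)
  then have "(block_start ^^ k) 7 = length ((subst_word ^^ k) (iter_a 3))"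
    using arg_cong[OF stake_block_start_pow[of k 7], of length] by simp
  then show ?thesis
    using block_start_pow_Suc[OF first_La_La(1), of k]
    by (simp only: funpow_add o_apply) simp
qed

section \<open>The cubes of a prefix\<close>

text \<open>
  A run of level \<open>k\<close> agrees with its shift along the run word, so a cube starts at every offset \<open>i\<close>
  after which two more periods fit into the run word. The root is a factor of the run word itself.
\<close>

definition cube_root :: "nat \<Rightarrow> nat \<Rightarrow> letter list" where
  "cube_root k i = take (length (iter_a k)) (drop i (run_word k))"

text \<open>
  The number \<open>c_k\<close> of these offsets. It is 0 at the levels 0, 1 and 2, where the agreement is one
  letter short of two periods.
\<close>

definition cube_count :: "nat \<Rightarrow> nat" where
  "cube_count k = Suc (length (run_word k)) - 2 * length (iter_a k)"

text \<open>
  The first run of level \<open>k\<close> starts at \<open>t_(k+3) - t_k\<close>, and the cube at its start has length \<open>3 t_k\<close>.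
\<close>

definition first_cube_end :: "nat \<Rightarrow> nat" where
  "first_cube_end k = length (iter_a (k + 3)) + 2 * length (iter_a k)"

lemma sublist_prefix_iff:
  "sublist xs (tribonacci_prefix n) \<longleftrightarrow>
    (\<exists>p. p + length xs \<le> n \<and> factor_at p (length xs) = xs)"
proof
  assume "sublist xs (tribonacci_prefix n)"
  then obtain ps ss where eq: "stake n tribonacci_word = ps @ xs @ ss"
    by (auto simp: sublist_def tribonacci_prefix_def)
  let ?p = "length ps"
  have n: "n = ?p + length xs + length ss" using arg_cong[OF eq, of length] by simp
  have "factor_at ?p (length xs) = xs"
  proof (rule nth_equalityI)
    fix i assume "i < length (factor_at ?p (length xs))"
    then have i: "i < length xs" by simp
    then have "tri (?p + i) = stake n tribonacci_word ! (?p + i)"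
      using n by (simp add: stake_nth)
    also have "\<dots> = xs ! i" using i by (simp add: eq nth_append)
    finally show "factor_at ?p (length xs) ! i = xs ! i" using i by simp
  qed simp
  then show "\<exists>p. p + length xs \<le> n \<and> factor_at p (length xs) = xs"
    using n by (intro exI[of _ ?p]) simp
next
  assume "\<exists>p. p + length xs \<le> n \<and> factor_at p (length xs) = xs"
  then obtain p where p: "p + length xs \<le> n" "factor_at p (length xs) = xs" by blast
  let ?r = "n - (p + length xs)"
  have "tribonacci_prefix n = factor_at 0 (p + (length xs + ?r))"
    using p(1) by (simp add: tribonacci_prefix_def factor_at_def)
  also have "\<dots> = factor_at 0 p @ xs @ factor_at (p + length xs) ?r"
    by (simp only: factor_at_add p(2) add_0)
  finally show "sublist xs (tribonacci_prefix n)" by (auto simp: sublist_def)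
qed

lemma cube_in_prefix_iff:
  "sublist (w @ w @ w) (tribonacci_prefix n) \<longleftrightarrow>
    (\<exists>p. p + 3 * length w \<le> n \<and> factor_at p (3 * length w) = w @ w @ w)"
proof -
  have "length (w @ w @ w) = 3 * length w" by simp
  then show ?thesis by (simp only: sublist_prefix_iff)
qed

text \<open>
  This turns a cube into an agreement with a shift, the form in which the classification applies.
\<close>

lemma factor_at_cube_iff:
  "factor_at p (3 * length w) = w @ w @ w \<longleftrightarrow>
    factor_at p (length w) = w \<and>
    factor_at p (2 * length w) = factor_at (p + length w) (2 * length w)"
  (is "?l \<longleftrightarrow> ?r")
proof -
  let ?L = "length w"
  have 3: "factor_at p (3 * ?L) = factor_at p ?L @ factor_at (p + ?L) ?L @ factor_at (p + ?L + ?L) ?L"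
    using factor_at_add[of p ?L "?L + ?L"] factor_at_add[of "p + ?L" ?L ?L]
    by (simp only: numeral_3_eq_3 mult_Suc mult_0 add_0_right)
  have 2: "factor_at q (2 * ?L) = factor_at q ?L @ factor_at (q + ?L) ?L" for q
    using factor_at_add[of q ?L ?L] by (simp add: mult_2)
  show ?thesis unfolding 3 2 by auto
qed

text \<open>
  The run word occurs at the images of both letters of the factor \<open>aa\<close>, and the two occurrences are
  one period apart.
\<close>

lemma factor_at_run:
  assumes "tri j = La" "tri (Suc j) = La" "i + l \<le> length (run_word k)"
  shows "factor_at ((block_start ^^ k) j + i) l = take l (drop i (run_word k))"
    and "factor_at ((block_start ^^ k) j + i) l
      = factor_at ((block_start ^^ k) j + i + length (iter_a k)) l"
proof -
  have *: "factor_at ((block_start ^^ k) j' + i) l = take l (drop i (run_word k))"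
    if "tri j' = La" for j'
  proof (rule nth_equalityI)
    fix x assume "x < length (factor_at ((block_start ^^ k) j' + i) l)"
    then have x: "x < l" by simp
    have "run_word k ! (i + x) = factor_at ((block_start ^^ k) j') (length (run_word k)) ! (i + x)"
      using factor_at_run_word[OF that] by simp
    then show "factor_at ((block_start ^^ k) j' + i) l ! x = take l (drop i (run_word k)) ! x"
      using x assms(3) by (simp add: add.assoc)
  qed (use assms(3) in simp)
  show "factor_at ((block_start ^^ k) j + i) l = take l (drop i (run_word k))"
    using * assms(1) .
  then show "factor_at ((block_start ^^ k) j + i) l
      = factor_at ((block_start ^^ k) j + i + length (iter_a k)) l"
    using *[OF assms(2)] block_start_pow_Suc[OF assms(1), of k] by (simp add: algebra_simps)
qed

lemma length_cube_root: "i < cube_count k \<Longrightarrow> length (cube_root k i) = length (iter_a k)"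
  by (simp add: cube_root_def cube_count_def)

text \<open>
  The position of the run that contains a cube does not influence its root, so only the first run of
  each level matters for whether a cube has appeared yet.
\<close>

lemma cubes_of_prefix:
  "{w. w \<noteq> [] \<and> sublist (w @ w @ w) (tribonacci_prefix n)} =
    {cube_root k i | k i. i < cube_count k \<and> first_cube_end k + i \<le> n}" (is "?A = ?B")
proof (intro set_eqI iffI)
  fix w assume "w \<in> ?A"
  then obtain p where "w \<noteq> []" and p: "p + 3 * length w \<le> n" "factor_at p (3 * length w) = w @ w @ w"
    by (auto simp only: mem_Collect_eq cube_in_prefix_iff)
  then have w: "factor_at p (length w) = w"
    and rep: "factor_at p (2 * length w) = factor_at (p + length w) (2 * length w)"
    by (simp_all add: factor_at_cube_iff)
  obtain k j i where kji: "tri j = La" "tri (Suc j) = La" "p = (block_start ^^ k) j + i"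
    "length w = length (iter_a k)" "i + 2 * length w \<le> length (run_word k)"
    using repetition_classification[OF _ order_refl rep] \<open>w \<noteq> []\<close>
    unfolding length_greater_0_conv by blast
  have "w = cube_root k i"
    using w factor_at_run(1)[OF kji(1,2), of i "length w" k] kji(3-5)
    by (simp add: cube_root_def)
  moreover have "i < cube_count k" using kji(4,5) by (simp add: cube_count_def)
  moreover have "(block_start ^^ k) 6 \<le> (block_start ^^ k) j"
    using first_La_La(3)[OF kji(1,2)] strict_mono_less_eq[OF strict_mono_block_start_pow] by blast
  then have "first_cube_end k + i \<le> n"
    using p(1) kji(3,4) block_start_pow_6[of k] by (simp add: first_cube_end_def)
  ultimately show "w \<in> ?B" by blast
next
  fix w assume "w \<in> ?B"
  then obtain k i where ki: "w = cube_root k i" "i < cube_count k" "first_cube_end k + i \<le> n"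
    by blast
  let ?p = "(block_start ^^ k) 6 + i"
  have len: "length w = length (iter_a k)" using ki(1,2) length_cube_root by simp
  have long: "i + 2 * length w \<le> length (run_word k)"
    using ki(2) len by (simp add: cube_count_def)
  have "factor_at ?p (length w) = w"
    using factor_at_run(1)[OF first_La_La(1,2), of i "length w" k] long ki(1) len
    by (simp add: cube_root_def)
  moreover have "factor_at ?p (2 * length w) = factor_at (?p + length w) (2 * length w)"
    using factor_at_run(2)[OF first_La_La(1,2) long] len by simp
  ultimately have "factor_at ?p (3 * length w) = w @ w @ w"
    by (simp add: factor_at_cube_iff)
  moreover have "?p + 3 * length w \<le> n"
    using ki(3) len block_start_pow_6[of k] by (simp add: first_cube_end_def)
  moreover have "w \<noteq> []" using len length_iter_a[of k] by auto
  ultimately show "w \<in> ?A"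
    unfolding mem_Collect_eq cube_in_prefix_iff by blast
qed

text \<open>
  The period length determines the level. Equal roots at two offsets \<open>a < b\<close> of one run would make the
  stretch of length \<open>3 t_k\<close> at \<open>a\<close> agree with its shift by \<open>b - a\<close>, which is less than \<open>t_k\<close>. By the
  classification this shift is some \<open>t_r\<close>, but the agreement with such a shift is shorter than \<open>3 t_r\<close>.
\<close>

lemma cube_root_inj:
  assumes i: "i < cube_count k" and i': "i' < cube_count k'"
    and eq: "cube_root k i = cube_root k' i'"
  shows "k = k' \<and> i = i'"
proof -
  have len: "length (iter_a k) = length (iter_a k')"
    using length_cube_root[OF i] length_cube_root[OF i'] eq by simp
  have "strict_mono (\<lambda>k. length (iter_a k))"
    unfolding strict_mono_Suc_iff
  proof
    fix k show "length (iter_a k) < length (iter_a (Suc k))"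
      using iter_a_extends[of k] by auto
  qed
  from strict_mono_eq[OF this, of k k'] have k: "k = k'" using len by blast
  let ?L = "length (iter_a k)"
  have False if less: "a < b" and b: "b < cube_count k" and ab: "cube_root k a = cube_root k b" for a b
  proof -
    let ?P = "\<lambda>a. (block_start ^^ k) 6 + a"
    have cube: "factor_at (?P c) (3 * ?L) = cube_root k c @ cube_root k c @ cube_root k c"
      if "c < cube_count k" for c
    proof -
      have long: "c + 2 * ?L \<le> length (run_word k)" using that by (simp add: cube_count_def)
      show ?thesis
        using factor_at_cube_iff[of "?P c" "cube_root k c"] length_cube_root[OF that]
          factor_at_run(1)[OF first_La_La(1,2), of c ?L k]
          factor_at_run(2)[OF first_La_La(1,2) long] long
        by (simp add: cube_root_def)
    qed
    have bL: "b \<le> ?L"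
      using b length_run_word[of k] length_iter_a_double[of k] length_iter_a_double[of "Suc k"]
      by (simp add: cube_count_def)
    have "factor_at (?P a) (3 * ?L) = factor_at (?P a + (b - a)) (3 * ?L)"
      using cube[of a] cube[of b] less b ab by simp
    moreover have "0 < b - a" "2 * (b - a) \<le> 3 * ?L" using less bL by linarith+
    ultimately obtain r c where r: "b - a = length (iter_a r)"
      "c + 3 * ?L \<le> length (run_word r)"
      using repetition_classification[of "b - a" "3 * ?L" "?P a"] by blast
    then show False
      using less bL length_run_word[of r] length_iter_a_double[of r] length_iter_a_double[of "Suc r"]
      by simp
  qed
  then have "i = i'" using i i' eq k by (metis linorder_neqE_nat)
  with k show ?thesis by blast
qed

text \<open>
  All cubes of one level have appeared before the first cube of the next level is complete. This
  produces the plateaus of the counting function.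
\<close>

lemma first_cube_end_Suc: "first_cube_end k + cube_count k \<le> first_cube_end (Suc k)"
  using length_iter_a_rec[of "Suc k"] length_run_word[of k] length_iter_a_mono[of k "Suc k"]
    length_iter_a_mono[of "Suc k" "k + 2"]
  by (simp add: first_cube_end_def cube_count_def numeral_3_eq_3)

lemma first_cube_end_mono: "k \<le> l \<Longrightarrow> first_cube_end k \<le> first_cube_end l"
  unfolding first_cube_end_def
  by (intro add_mono mult_left_mono length_iter_a_mono) auto

section \<open>The counting function\<close>

lemma num_cubes_eq_sum:
  assumes "n < first_cube_end (Suc K)"
  shows "num_cubes n = (\<Sum>k<K. card {i. i < cube_count k \<and> first_cube_end k + i \<le> n})
    + card {i. i < cube_count K \<and> first_cube_end K + i \<le> n}"
proof -
  let ?I = "\<lambda>k. {i. i < cube_count k \<and> first_cube_end k + i \<le> n}"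
  have small: "k < Suc K" if "first_cube_end k \<le> n" for k
    using that assms first_cube_end_mono[of "Suc K" k] by (meson le_trans not_less)
  have "{w. w \<noteq> [] \<and> sublist (w @ w @ w) (tribonacci_prefix n)} =
      (\<lambda>(k, i). cube_root k i) ` (SIGMA k : {..<Suc K}. ?I k)"
    unfolding cubes_of_prefix
  proof (intro set_eqI iffI)
    fix w assume "w \<in> {cube_root k i | k i. i < cube_count k \<and> first_cube_end k + i \<le> n}"
    then obtain k i where "w = cube_root k i" "i < cube_count k" "first_cube_end k + i \<le> n"
      by blast
    moreover from this have "k < Suc K" using small[of k] by linarith
    ultimately show "w \<in> (\<lambda>(k, i). cube_root k i) ` (SIGMA k : {..<Suc K}. ?I k)"
      by (intro image_eqI[of _ _ "(k, i)"]) auto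
  qed auto
  moreover have "inj_on (\<lambda>(k, i). cube_root k i) (SIGMA k : {..<Suc K}. ?I k)"
    using cube_root_inj by (auto simp: inj_on_def)
  ultimately have "num_cubes n = card (SIGMA k : {..<Suc K}. ?I k)"
    by (simp add: num_cubes_def card_image)
  also have "\<dots> = (\<Sum>k<Suc K. card (?I k))"
    by (intro card_SigmaI) auto
  finally show ?thesis by simp
qed

lemma cube_count_less_3: "k < 3 \<Longrightarrow> cube_count k = 0"
  by (auto simp: cube_count_def less_Suc_eq numeral_3_eq_3)

lemma num_cubes_less_58: "n \<le> 57 \<Longrightarrow> num_cubes n = 0"
proof -
  assume n: "n \<le> 57"
  have "first_cube_end 3 = 58" by (simp add: first_cube_end_def eval_nat_numeral)
  then have "num_cubes n = (\<Sum>k<Suc 2. card {i. i < cube_count k \<and> first_cube_end k + i \<le> n})"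
    using num_cubes_eq_sum[of n 2] n by (simp add: numeral_3_eq_3 numeral_2_eq_2)
  also have "\<dots> = 0"
    by (intro sum.neutral) (auto simp: cube_count_less_3)
  finally show ?thesis .
qed

text \<open>
  Levels are shifted by 3 in order to avoid negative indices: with \<open>k = r + 3\<close> this is
  \<open>2 c_k = t_(k-1) - t_(k-3) - 1\<close>.
\<close>

lemma twice_cube_count:
  "2 * cube_count (r + 3) + length (iter_a r) + 1 = length (iter_a (r + 2))"
proof -
  define t where "t k = length (iter_a k)" for k
  have rec: "t (k + 3) = t (k + 2) + t (k + 1) + t k" for k
    unfolding t_def by (rule length_iter_a_rec)
  have "r + 3 + 2 = r + 5" by simp
  then have "2 * length (run_word (r + 3)) + 3 = t (r + 5) + t (r + 3)"
    using length_run_word[of "r + 3"] by (simp only: t_def)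
  moreover have "t (r + 3) = t (r + 2) + t (r + 1) + t r" by (rule rec)
  moreover have "t (r + 4) = t (r + 3) + t (r + 2) + t (r + 1)"
    using rec[of "r + 1"] by (simp add: eval_nat_numeral)
  moreover have "t (r + 5) = t (r + 4) + t (r + 3) + t (r + 2)"
    using rec[of "r + 2"] by (simp add: eval_nat_numeral)
  moreover have "r < t r" "t r \<le> t (r + 2)"
    unfolding t_def using length_iter_a length_iter_a_mono[of r "r + 2"] by simp_all
  ultimately show ?thesis
    unfolding cube_count_def t_def[symmetric] by arith
qed

lemma sum_cube_count:
  "2 * (\<Sum>k<r + 3. cube_count k) + r + 3 = length (iter_a (Suc r)) + length (iter_a r)"
proof (induction r)
  case 0
  have "(\<Sum>k<0 + 3. cube_count k) = 0"
    by (intro sum.neutral) (auto intro: cube_count_less_3)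
  then show ?case by (simp add: length_iter_a_small)
next
  case (Suc r)
  have "(\<Sum>k<Suc r + 3. cube_count k) = (\<Sum>k<r + 3. cube_count k) + cube_count (r + 3)"
    by (simp only: add_Suc sum.lessThan_Suc)
  moreover have "r + 2 = Suc (Suc r)" by simp
  then have "2 * cube_count (r + 3) + length (iter_a r) + 1 = length (iter_a (Suc (Suc r)))"
    using twice_cube_count[of r] by (simp only:)
  ultimately show ?case using Suc.IH by linarith
qed

lemma num_cubes_between:
  assumes "first_cube_end K \<le> n" "n < first_cube_end (Suc K)"
  shows "num_cubes n = (\<Sum>k<K. cube_count k) + min (cube_count K) (n + 1 - first_cube_end K)"
proof -
  have "card {i. i < cube_count k \<and> first_cube_end k + i \<le> n} = cube_count k" if "k < K" for k
  proof -
    have "first_cube_end k + cube_count k \<le> n"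
      using first_cube_end_Suc[of k] first_cube_end_mono[of "Suc k" K] that assms(1) by simp
    then have "{i. i < cube_count k \<and> first_cube_end k + i \<le> n} = {..<cube_count k}" by auto
    then show ?thesis by simp
  qed
  moreover have "{i. i < cube_count K \<and> first_cube_end K + i \<le> n} =
      {..<min (cube_count K) (n + 1 - first_cube_end K)}" by auto
  ultimately show ?thesis
    using num_cubes_eq_sum[OF assms(2)] by simp
qed

lemma trib_mono: "mono trib"
proof -
  have nonneg: "0 \<le> trib m" for m
  proof (cases "m \<le> 0")
    case True
    then show ?thesis by (simp add: trib.simps[of m])
  next
    case False
    then show ?thesis using trib_eq_length_iter_a[of "nat m"] by simp
  qed
  have step: "trib m \<le> trib (m + 1)" for m
  proof (cases "0 \<le> m")
    case True
    then show ?thesis using trib_rec[of "m + 1"] nonneg[of "m - 1"] nonneg[of "m - 2"] by simp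
  next
    case False
    then have "m \<le> -2 \<or> m = -1" by linarith
    then show ?thesis
    proof
      assume "m \<le> -2"
      then show ?thesis using nonneg[of "m + 1"] by (simp add: trib.simps[of m])
    qed (simp add: trib_initial)
  qed
  show ?thesis
  proof (rule monoI)
    fix x y :: int assume "x \<le> y"
    then show "trib x \<le> trib y"
      by (induction rule: int_ge_induct) (use step order_trans in blast)+
  qed
qed

text \<open>
  The formula of the theorem in integers, for the prefix lengths that belong to level \<open>k = r + 3\<close>, with
  \<open>m = k + 4\<close>.
\<close>

lemma twice_num_cubes:
  fixes m :: int
  assumes r: "m = int r + 7"
    and n: "first_cube_end (r + 3) \<le> n" "n < first_cube_end (Suc (r + 3))"
  shows "2 * int (num_cubes n) =
    (if 2 * int n \<le> 3 * trib (m - 1) - trib (m - 3) - 3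
     then 2 * int n - (4 * trib (m - 1) - trib (m - 2) - 3 * trib (m - 3) + m - 6)
     else trib (m - 5) + trib (m - 6) - m + 3)"
proof -
  define t where "t k = int (length (iter_a k))" for k
  have trib: "trib (m - 1) = t (r + 6)" "trib (m - 2) = t (r + 5)" "trib (m - 3) = t (r + 4)"
    "trib (m - 5) = t (r + 2)" "trib (m - 6) = t (r + 1)"
    using trib_eq_length_iter_a[of "r + 6"] trib_eq_length_iter_a[of "r + 5"]
      trib_eq_length_iter_a[of "r + 4"] trib_eq_length_iter_a[of "r + 2"]
      trib_eq_length_iter_a[of "r + 1"] by (simp_all add: r t_def add.commute)
  have rec: "t (k + 3) = t (k + 2) + t (k + 1) + t k" for k
    unfolding t_def length_iter_a_rec by simp
  have recs: "t (r + 3) = t (r + 2) + t (r + 1) + t r"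
    "t (r + 4) = t (r + 3) + t (r + 2) + t (r + 1)"
    "t (r + 5) = t (r + 4) + t (r + 3) + t (r + 2)"
    "t (r + 6) = t (r + 5) + t (r + 4) + t (r + 3)"
    using rec[of r] rec[of "r + 1"] rec[of "r + 2"] rec[of "r + 3"]
    by (simp_all add: eval_nat_numeral)
  define E where "E = first_cube_end (r + 3)"
  define c where "c = cube_count (r + 3)"
  define S where "S = (\<Sum>k<r + 3. cube_count k)"
  have "r + 3 + 3 = r + 6" by simp
  then have E: "int E = t (r + 6) + 2 * t (r + 3)"
    by (simp only: E_def first_cube_end_def t_def of_nat_add of_nat_mult of_nat_numeral)
  have S: "2 * int S + int r + 3 = t (r + 1) + t r"
    using sum_cube_count[of r] unfolding S_def t_def Suc_eq_plus1 by linarith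
  have c: "2 * int c + t r + 1 = t (r + 2)"
    unfolding c_def t_def using twice_cube_count[of r] by linarith
  have "E \<le> n" using n(1) by (simp only: E_def)
  have "num_cubes n = S + min c (n + 1 - E)"
    unfolding E_def c_def S_def using n by (rule num_cubes_between)
  then have B: "int (num_cubes n) = int S + min (int c) (int n + 1 - int E)"
    using \<open>E \<le> n\<close> by linarith
  show ?thesis
  proof (cases "2 * int n \<le> 3 * t (r + 6) - t (r + 4) - 3")
    case True
    (* The bound on 2 n is twice the end of the last cube of the level, that is 2 (E + c - 1). *)
    then have "2 * int (num_cubes n) =
        2 * int n - (4 * t (r + 6) - t (r + 5) - 3 * t (r + 4) + m - 6)"
      using B S c E recs r by linarith
    with True show ?thesis unfolding trib by simp
  next
    case False
    then have "2 * int (num_cubes n) = t (r + 2) + t (r + 1) - m + 3"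
      using B S c E recs r by linarith
    with False show ?thesis unfolding trib by simp
  qed
qed

text \<open>
  The bounds on \<open>n\<close> are consecutive values of the monotone function \<open>g m = t_m + 2 t_(m-3)\<close>, which at
  \<open>m = k + 3\<close> is the end of the first cube of level \<open>k\<close>. Since \<open>g 6 = 58\<close>, no \<open>m\<close> below 7 is possible.
\<close>

theorem theorem5p1:
  fixes n :: nat
  shows "(n \<le> 57 \<longrightarrow> num_cubes n = 0) \<and>
    (n \<ge> 58 \<longrightarrow>
      (\<exists>!m::int. trib (m - 1) + 2 * trib (m - 4) \<le> int n \<and> int n < trib m + 2 * trib (m - 3)) \<and>
      (\<forall>m::int. trib (m - 1) + 2 * trib (m - 4) \<le> int n \<and> int n < trib m + 2 * trib (m - 3) \<longrightarrow>
        m \<ge> 7 \<and>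
        real (num_cubes n) =
          (if real n \<le> real_of_int (3 * trib (m - 1) - trib (m - 3) - 3) / 2
           then real n - 1 / 2 *
             real_of_int (4 * trib (m - 1) - trib (m - 2) - 3 * trib (m - 3) + m - 6)
           else 1 / 2 * real_of_int (trib (m - 5) + trib (m - 6) - m + 3))))"
proof (intro conjI impI)
  show "num_cubes n = 0" if "n \<le> 57" using num_cubes_less_58 that .
next
  assume n: "n \<ge> 58"
  define g where "g m = trib m + 2 * trib (m - 3)" for m
  have g_mono: "g x \<le> g y" if "x \<le> y" for x y
    unfolding g_def using that by (intro add_mono mult_left_mono monoD[OF trib_mono]) auto
  have g_nat: "g (int k + 3) = int (first_cube_end k)" for k
    using trib_eq_length_iter_a[of "k + 3"] trib_eq_length_iter_a[of k]
    by (simp add: g_def first_cube_end_def)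
  have bounds: "trib (m - 1) + 2 * trib (m - 4) \<le> int n \<and> int n < trib m + 2 * trib (m - 3) \<longleftrightarrow>
      g (m - 1) \<le> int n \<and> int n < g m" for m
    by (simp add: g_def)
  have "first_cube_end 3 = 58" by (simp add: first_cube_end_def eval_nat_numeral)
  then have g6: "g 6 = 58" using g_nat[of 3] by simp
  have unique: "m = m'" if "g (m - 1) \<le> int n" "int n < g m" "g (m' - 1) \<le> int n" "int n < g m'" for m m'
    using that g_mono[of m "m' - 1"] g_mono[of m' "m - 1"] by linarith
  have param: "\<exists>r. m = int r + 7" if "int n < g m" for m
  proof -
    have "6 < m" using that n g6 g_mono[of m 6] by linarith
    then show ?thesis by (intro exI[of _ "nat (m - 7)"]) simp
  qed
  show "\<exists>!m. trib (m - 1) + 2 * trib (m - 4) \<le> int n \<and> int n < trib m + 2 * trib (m - 3)"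
    unfolding bounds
  proof (rule ex_ex1I)
    let ?P = "\<lambda>K. n < first_cube_end K"
    have "?P n" using length_iter_a[of n] by (simp add: first_cube_end_def)
    define K where "K = (LEAST K. ?P K)"
    have K: "n < first_cube_end K" unfolding K_def using \<open>?P n\<close> by (rule LeastI)
    have "3 < K"
      using K n \<open>first_cube_end 3 = 58\<close> first_cube_end_mono[of K 3] by linarith
    then have "\<not> ?P (K - 1)"
      using not_less_Least[of "K - 1" ?P] unfolding K_def by simp
    then show "\<exists>m. g (m - 1) \<le> int n \<and> int n < g m"
      using K g_nat[of K] g_nat[of "K - 1"] \<open>3 < K\<close>
      by (intro exI[of _ "int K + 3"]) (simp add: of_nat_diff algebra_simps)
  qed (use unique in blast)
  show "\<forall>m::int. trib (m - 1) + 2 * trib (m - 4) \<le> int n \<and> int n < trib m + 2 * trib (m - 3) \<longrightarrow>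
        m \<ge> 7 \<and>
        real (num_cubes n) =
          (if real n \<le> real_of_int (3 * trib (m - 1) - trib (m - 3) - 3) / 2
           then real n - 1 / 2 *
             real_of_int (4 * trib (m - 1) - trib (m - 2) - 3 * trib (m - 3) + m - 6)
           else 1 / 2 * real_of_int (trib (m - 5) + trib (m - 6) - m + 3))"
    unfolding bounds
  proof (intro allI impI)
    fix m assume m: "g (m - 1) \<le> int n \<and> int n < g m"
    then obtain r where r: "m = int r + 7" using param by blast
    show "m \<ge> 7 \<and>
        real (num_cubes n) =
          (if real n \<le> real_of_int (3 * trib (m - 1) - trib (m - 3) - 3) / 2
           then real n - 1 / 2 *
             real_of_int (4 * trib (m - 1) - trib (m - 2) - 3 * trib (m - 3) + m - 6)
           else 1 / 2 * real_of_int (trib (m - 5) + trib (m - 6) - m + 3))"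
    proof
      show "7 \<le> m" using r by simp
      have "first_cube_end (r + 3) \<le> n" "n < first_cube_end (Suc (r + 3))"
        using m g_nat[of "r + 3"] g_nat[of "Suc (r + 3)"] r by (simp_all add: algebra_simps)
      note twice = twice_num_cubes[OF r this]
      have half_le: "real x \<le> real_of_int a / 2 \<longleftrightarrow> 2 * int x \<le> a" for x a
        using of_int_le_iff[of "2 * int x" a, where 'a = real] by auto
      have half_diff: "real x = real y - 1 / 2 * real_of_int a \<longleftrightarrow> 2 * int x = 2 * int y - a"
        for x y a
        using of_int_eq_iff[of "2 * int x" "2 * int y - a", where 'a = real] by auto
      have half_eq: "real x = 1 / 2 * real_of_int a \<longleftrightarrow> 2 * int x = a" for x a
        using of_int_eq_iff[of "2 * int x" a, where 'a = real] by auto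
      show "real (num_cubes n) =
          (if real n \<le> real_of_int (3 * trib (m - 1) - trib (m - 3) - 3) / 2
           then real n - 1 / 2 *
             real_of_int (4 * trib (m - 1) - trib (m - 2) - 3 * trib (m - 3) + m - 6)
           else 1 / 2 * real_of_int (trib (m - 5) + trib (m - 6) - m + 3))"
        using twice unfolding half_le
        by (auto simp only: half_diff half_eq split: if_splits)
    qed
  qed
qed

end
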